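(* Let $R=\mathbb{F}_2[x]/(x^p+1)$ with $p\ge 1$ an integer. Let $\mathcal{Q}$ be a lifted product code over $R$ with check matrices $(H_X,H_Z)$ and let $\mathcal{P}$ be a corresponding product connection code with check matrices $(H_X',H_Z')$. Then taking the auxiliary code to be a copy $\mathcal{Q}^{\mathrm{aux}}=\mathcal{Q}$ of the data code, $Q_2^{\mathrm{aux}}\xrightarrow{H_Z^*}Q_1^{\mathrm{aux}}\xrightarrow{H_X}Q_0^{\mathrm{aux}}$, and the connecting maps to be ${H_Z'}^{*}:Q_2^{\mathrm{aux}}\to Q_1$ and $H_X':Q_1^{\mathrm{aux}}\to Q_0$ gives a valid ($Z$-type) code surgery (that is, the diagram commutes: $H_X'\,H_Z^{*}=H_X\,{H_Z'}^{*}$), and the corresponding merged CSS code has check matrices $$\widetilde{H_X}=\begin{pmatrix} H_X & H_X' \\ 0 & H_X \end{pmatrix},\qquad \widetilde{H_Z}=\begin{pmatrix} H_Z & 0 \\ H_Z' & H_Z \end{pmatrix}.$$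
   Context: For $q=\sum_i q_ix^i\in R$, $q^*=\sum_i q_ix^{-i}$ (exponents mod $p$); for a matrix $M$ over $R$, $M^*=(M_{j,i}^* )$ is the conjugate transpose. Lifted product (LP) code: for matrices $H_a\in R^{m_a\times n_a}$ and $H_b\in R^{m_b\times n_b}$ over $R$, $\mathrm{LP}(H_a,H_b)$ is the CSS code with check matrices $$H_X=(\,H_a\otimes_R I_{m_b}\mid I_{m_a}\otimes_R H_b\,),\qquad H_Z=(\,I_{n_a}\otimes_R H_b^*\mid H_a^*\otimes_R I_{n_b}\,),$$ regarded as the length-2 chain complex $Q_2\xrightarrow{H_Z^*}Q_1\xrightarrow{H_X}Q_0$ of free $R$-modules (so $H_XH_Z^*=0$). Product connection code: given an LP code $\mathcal{Q}$ over $R$ with check matrices $(H_X,H_Z)$, a corresponding product connection code $\mathcal{P}$ is another LP code over $R$ whose check matrices $(H_X',H_Z')$ have the same size as $(H_X,H_Z)$. Code surgery: given a data CSS code $Q_2\xrightarrow{H_Z^*}Q_1\xrightarrow{H_X}Q_0$ and an auxiliary CSS code $U_1\xrightarrow{\partial_1}U_0\xrightarrow{\partial_0}U_{-1}$, a $Z$-type code surgery is given by maps $f_1:U_1\to Q_1$ and $f_0:U_0\to Q_0$ such that the resulting diagram commutes, i.e. $f_0\partial_1=H_Xf_1$. The merged code is the CSS code with check matrices $\widetilde{H_X}=\begin{pmatrix} H_X & f_0 \\ 0 & \partial_0 \end{pmatrix}$ and $\widetilde{H_Z}=\begin{pmatrix} H_Z & 0 \\ f_1^* & \partial_1^* \end{pmatrix}$,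 which satisfies the CSS condition $\widetilde{H_X}\widetilde{H_Z}^*=0$ whenever the diagram commutes.
   Formalization: The product connection code is required to come from factors H_a', H_b' of the same sizes as H_a, H_b; equal sizes of the check matrices alone do not suffice, e.g. H_a=(1,0), H_b=(0), H_a'=(0), H_b'=(0,1) makes the diagram fail to commute. *)

theory Defs
  imports
    "HOL-Library.Z2"
    "HOL-Computational_Algebra.Polynomial"
    "HOL-Analysis.Finite_Cartesian_Product"
    "Jordan_Normal_Form.Matrix"
begin

text \<open>
  The ring F_2[x]/(x^p + 1). The integer p \<ge> 1 is the cardinality of the finite index type 'p
  (every p \<ge> 1 occurs as such a cardinality), which makes the quotient a type of class
  \<^class>\<open>comm_ring_1\<close>, as required for the entries of matrices.
\<close>

definition modulus :: "'p::finite itself \<Rightarrow> bit poly" where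
  "modulus _ = monom 1 CARD('p) + 1"

quotient_type (overloaded) 'p lift_ring =
  "bit poly" / "\<lambda>f g. f mod modulus TYPE('p::finite) = g mod modulus TYPE('p)"
  by (auto intro!: equivpI reflpI sympI transpI)

lemma degree_modulus: "degree (modulus TYPE('p::finite)) = CARD('p)"
  by (simp add: modulus_def degree_add_eq_left degree_monom_eq)

instantiation lift_ring :: (finite) comm_ring_1
begin

lift_definition zero_lift_ring :: "'a lift_ring" is 0 .
lift_definition one_lift_ring :: "'a lift_ring" is 1 .
lift_definition plus_lift_ring :: "'a lift_ring \<Rightarrow> 'a lift_ring \<Rightarrow> 'a lift_ring" is "(+)"
  by (rule mod_add_cong)
lift_definition uminus_lift_ring :: "'a lift_ring \<Rightarrow> 'a lift_ring" is uminus
  by (rule mod_minus_cong)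
lift_definition minus_lift_ring :: "'a lift_ring \<Rightarrow> 'a lift_ring \<Rightarrow> 'a lift_ring" is "(-)"
  by (rule mod_diff_cong)
lift_definition times_lift_ring :: "'a lift_ring \<Rightarrow> 'a lift_ring \<Rightarrow> 'a lift_ring" is "(*)"
  by (rule mod_mult_cong)

instance
proof
  show "(0 :: 'a lift_ring) \<noteq> 1"
  proof transfer
    have "degree (1 :: bit poly) < degree (modulus TYPE('a))"
      by (simp add: degree_modulus)
    then show "0 mod modulus TYPE('a) \<noteq> 1 mod modulus TYPE('a)"
      by (simp add: mod_poly_less)
  qed
qed (transfer; simp add: algebra_simps)+

end

text \<open>
  The involution sending \<Sum> q_i x^i to \<Sum> q_i x^(-i), where the q_i with i < p are the
  coefficients of the reduced representative and (p - i) mod p is -i modulo p.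
\<close>

lift_definition star :: "'p::finite lift_ring \<Rightarrow> 'p lift_ring" is
  "\<lambda>q. \<Sum>i<CARD('p). monom (coeff (q mod modulus TYPE('p)) i) ((CARD('p) - i) mod CARD('p))"
  by simp

definition conj_transpose :: "'p::finite lift_ring mat \<Rightarrow> 'p lift_ring mat" where
  "conj_transpose M = map_mat star (transpose_mat M)"

definition kronecker :: "'a::comm_ring_1 mat \<Rightarrow> 'a mat \<Rightarrow> 'a mat" where
  "kronecker A B = mat (dim_row A * dim_row B) (dim_col A * dim_col B)
     (\<lambda>(i, j). A $$ (i div dim_row B, j div dim_col B) * B $$ (i mod dim_row B, j mod dim_col B))"

text \<open>The block row (A | B), for matrices with equally many rows.\<close>

definition block_row :: "'a::zero mat \<Rightarrow> 'a mat \<Rightarrow> 'a mat" where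
  "block_row A B = four_block_mat A B (0\<^sub>m 0 (dim_col A)) (0\<^sub>m 0 (dim_col B))"

text \<open>
  A code is given by its pair (H_X, H_Z) of check matrices over the ring. It is identified with
  the complex whose maps are the conjugate transpose of H_Z followed by H_X. The maps of a complex
  of free modules are given by their matrices, acting on column vectors.
\<close>

type_synonym 'p check_matrices = "'p lift_ring mat \<times> 'p lift_ring mat"

definition chain_complex :: "'a::comm_ring_1 mat \<Rightarrow> 'a mat \<Rightarrow> bool" where
  "chain_complex d1 d0 \<longleftrightarrow>
     dim_row d1 = dim_col d0 \<and> d0 * d1 = 0\<^sub>m (dim_row d0) (dim_col d1)"

fun css_code :: "'p::finite check_matrices \<Rightarrow> bool" where
  "css_code (HX, HZ) \<longleftrightarrow> chain_complex (conj_transpose HZ) HX"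

definition lifted_product ::
  "'p::finite lift_ring mat \<Rightarrow> 'p lift_ring mat \<Rightarrow> 'p check_matrices" where
  "lifted_product Ha Hb =
     (block_row (kronecker Ha (1\<^sub>m (dim_row Hb))) (kronecker (1\<^sub>m (dim_row Ha)) Hb),
      block_row (kronecker (1\<^sub>m (dim_col Ha)) (conj_transpose Hb))
                (kronecker (conj_transpose Ha) (1\<^sub>m (dim_col Hb))))"

text \<open>
  The matrices Ha and Hb are the factors defining the data code. The factors of the product
  connection code have the same sizes, so that the check matrices of the two codes agree in size
  block by block. Equality of the total sizes alone would not make the surgery diagram commute.
\<close>

definition product_connection_code ::
  "'p::finite lift_ring mat \<Rightarrow> 'p lift_ring mat \<Rightarrow> 'p check_matrices \<Rightarrow> bool" where
  "product_connection_code Ha Hb P \<longleftrightarrow>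
     (\<exists>Ha' \<in> carrier_mat (dim_row Ha) (dim_col Ha). \<exists>Hb' \<in> carrier_mat (dim_row Hb) (dim_col Hb).
        P = lifted_product Ha' Hb')"

text \<open>
  Surgery between a data code (H_X, H_Z) and an auxiliary complex with maps d1 and d0, along
  f1 and f0.
\<close>

fun Z_surgery ::
  "'p::finite check_matrices \<Rightarrow> 'p lift_ring mat \<times> 'p lift_ring mat \<Rightarrow>
   'p lift_ring mat \<Rightarrow> 'p lift_ring mat \<Rightarrow> bool" where
  "Z_surgery (HX, HZ) (d1, d0) f1 f0 \<longleftrightarrow>
     css_code (HX, HZ) \<and> chain_complex d1 d0 \<and>
     f1 \<in> carrier_mat (dim_col HX) (dim_col d1) \<and>
     f0 \<in> carrier_mat (dim_row HX) (dim_row d1) \<and>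
     f0 * d1 = HX * f1"

fun merged_code ::
  "'p::finite check_matrices \<Rightarrow> 'p lift_ring mat \<times> 'p lift_ring mat \<Rightarrow>
   'p lift_ring mat \<Rightarrow> 'p lift_ring mat \<Rightarrow> 'p check_matrices" where
  "merged_code (HX, HZ) (d1, d0) f1 f0 =
     (four_block_mat HX f0 (0\<^sub>m (dim_row d0) (dim_col HX)) d0,
      four_block_mat HZ (0\<^sub>m (dim_row HZ) (dim_row d1)) (conj_transpose f1) (conj_transpose d1))"

end

theory Submission
  imports Defs
begin

text \<open>
  By the mixed product rule for Kronecker products, both ways around the square equal
  Ha \<otimes> Hb' + Ha' \<otimes> Hb. For equal factors this is twice Ha \<otimes> Hb, which vanishes in
  characteristic 2, so a lifted product code is a CSS code; the corner entry of the product of the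
  merged check matrices vanishes for the same reason.
\<close>

section \<open>Characteristic 2 and the involution \<open>star\<close>\<close>

lemma lift_ring_add_self: "a + a = (0 :: 'p::finite lift_ring)"
proof transfer
  fix q :: "bit poly"
  have "q + q = 0"
    by (rule poly_eqI) (simp only: coeff_add add_bit_eq_xor xor_self_eq coeff_0)
  then show "(q + q) mod modulus TYPE('p) = 0 mod modulus TYPE('p)"
    by (simp only:)
qed

lemma star_0 [simp]: "star (0 :: 'p::finite lift_ring) = 0"
  by transfer simp

lemma mod_modulus_eq_self:
  "degree q < CARD('p) \<Longrightarrow> q mod modulus TYPE('p::finite) = q"
  by (simp add: mod_poly_less degree_modulus)

lemma star_1 [simp]: "star (1 :: 'p::finite lift_ring) = 1"
proof transfer
  have "(\<Sum>i<CARD('p). monom (coeff (1 :: bit poly) i) ((CARD('p) - i) mod CARD('p)))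
      = (\<Sum>i<CARD('p). if i = 0 then 1 else 0)"
    by (rule sum.cong) auto
  also have "\<dots> = 1"
    by simp
  finally show "(\<Sum>i<CARD('p). monom (coeff (1 mod modulus TYPE('p)) i)
      ((CARD('p) - i) mod CARD('p))) mod modulus TYPE('p) = 1 mod modulus TYPE('p)"
    by (simp add: mod_modulus_eq_self)
qed

text \<open>\<open>(n - i) mod n\<close> is -i modulo n. The case i = 0 is separate because n - 0 =
  n wraps around to 0.\<close>

lemma neg_mod_involution:
  fixes n i :: nat
  assumes "i < n"
  shows "(n - (n - i) mod n) mod n = i"
  using assms by (cases "i = 0") auto

text \<open>\<open>star\<close> permutes the coefficients of the reduced representative by i -> -i
  modulo p, and this permutation is its own inverse.\<close>

lemma star_star [simp]: "star (star a) = (a :: 'p::finite lift_ring)"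
proof transfer
  fix q :: "bit poly"
  let ?n = "CARD('p)"
  define r where "r = q mod modulus TYPE('p)"
  define s where "s = (\<Sum>i<?n. monom (coeff r i) ((?n - i) mod ?n))"
  \<comment> \<open>Only the summand with -i = j modulo p contributes, that is, i = -j.\<close>
  have coeff_s: "coeff s j = coeff r ((?n - j) mod ?n)" if "j < ?n" for j
  proof -
    have "coeff s j = (\<Sum>i<?n. if i = (?n - j) mod ?n then coeff r i else 0)"
      unfolding s_def coeff_sum using that
      by (intro sum.cong) (auto simp: neg_mod_involution)
    then show ?thesis by simp
  qed
  \<comment> \<open>All exponents are reduced modulo p, so \<open>s\<close> is already the reduced
    representative and the second \<open>star\<close> reads off its coefficients.\<close>
  have "degree s < ?n"
  proof -
    have "degree (monom (coeff r i) ((?n - i) mod ?n)) \<le> ?n - 1" for i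
    proof -
      have "(?n - i) mod ?n < ?n"
        by (rule mod_less_divisor) simp
      with degree_monom_le[of "coeff r i" "(?n - i) mod ?n"] show ?thesis
        by linarith
    qed
    then have "degree s \<le> ?n - 1"
      unfolding s_def by (intro degree_sum_le) auto
    then show ?thesis
      using zero_less_card_finite[where 'a='p] by linarith
  qed
  then have s: "s mod modulus TYPE('p) = s"
    by (rule mod_modulus_eq_self)
  \<comment> \<open>The degree bound for remainders concerns nonzero ones; for \<open>r = 0\<close>
    it holds since p \<ge> 1.\<close>
  have deg_r: "degree r < ?n"
  proof (cases "r = 0")
    case False
    moreover have "modulus TYPE('p) \<noteq> 0"
      using degree_modulus[where 'p='p] by (metis degree_0 zero_less_card_finite less_irrefl)
    ultimately show ?thesis
      using degree_mod_less'[of "modulus TYPE('p)" q] by (simp add: r_def degree_modulus)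
  qed simp
  have "(\<Sum>i<?n. monom (coeff s i) ((?n - i) mod ?n)) = r"
  proof (rule poly_eqI)
    fix j
    show "coeff (\<Sum>i<?n. monom (coeff s i) ((?n - i) mod ?n)) j = coeff r j"
    proof (cases "j < ?n")
      case True
      have "coeff (\<Sum>i<?n. monom (coeff s i) ((?n - i) mod ?n)) j
          = (\<Sum>i<?n. if i = (?n - j) mod ?n then coeff s i else 0)"
        unfolding coeff_sum using True
        by (intro sum.cong) (auto simp: neg_mod_involution)
      also have "\<dots> = coeff r j"
        using True by (simp add: coeff_s neg_mod_involution)
      finally show ?thesis .
    next
      \<comment> \<open>From p on both sides vanish: on the left no exponent reaches j, on the right
        by the degree bound.\<close>
      case False
      moreover have "(?n - i) mod ?n \<noteq> j" for i
        using False mod_less_divisor[of ?n "?n - i"] by auto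
      ultimately show ?thesis
        using deg_r by (auto simp: coeff_sum coeff_eq_0)
    qed
  qed
  then show "(\<Sum>i<?n. monom (coeff ((\<Sum>i<?n. monom (coeff (q mod modulus TYPE('p)) i)
      ((?n - i) mod ?n)) mod modulus TYPE('p)) i) ((?n - i) mod ?n)) mod modulus TYPE('p)
      = q mod modulus TYPE('p)"
    by (simp add: r_def[symmetric] s_def[symmetric] s) (simp add: r_def)
qed

section \<open>Conjugate transposition\<close>

lemma dim_conj_transpose [simp]:
  "dim_row (conj_transpose M) = dim_col M" "dim_col (conj_transpose M) = dim_row M"
  by (simp_all add: conj_transpose_def)

lemma index_conj_transpose [simp]:
  "i < dim_col M \<Longrightarrow> j < dim_row M \<Longrightarrow> conj_transpose M $$ (i, j) = star (M $$ (j, i))"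
  by (simp add: conj_transpose_def)

lemma conj_transpose_conj_transpose [simp]: "conj_transpose (conj_transpose M) = M"
  by (rule eq_matI) auto

lemma conj_transpose_zero [simp]: "conj_transpose (0\<^sub>m m n) = 0\<^sub>m n m"
  by (rule eq_matI) auto

lemma conj_transpose_four_block_mat:
  assumes "A \<in> carrier_mat r1 c1" "B \<in> carrier_mat r1 c2"
    "C \<in> carrier_mat r2 c1" "D \<in> carrier_mat r2 c2"
  shows "conj_transpose (four_block_mat A B C D) =
    four_block_mat (conj_transpose A) (conj_transpose C) (conj_transpose B) (conj_transpose D)"
  using assms by (intro eq_matI) auto

section \<open>Kronecker products and the mixed product rule\<close>

lemma dim_kronecker [simp]:
  "dim_row (kronecker A B) = dim_row A * dim_row B"
  "dim_col (kronecker A B) = dim_col A * dim_col B"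
  by (simp_all add: kronecker_def)

lemma index_kronecker [simp]:
  assumes "i < dim_row A * dim_row B" "j < dim_col A * dim_col B"
  shows "kronecker A B $$ (i, j) =
    A $$ (i div dim_row B, j div dim_col B) * B $$ (i mod dim_row B, j mod dim_col B)"
  using assms by (simp add: kronecker_def)

text \<open>The assumption excludes n = 0.\<close>

lemma mod_less_of_less_mult: "i < m * n \<Longrightarrow> i mod n < (n :: nat)"
  by (cases "n = 0") auto

text \<open>Each entry is a product with a factor 0 or 1, which \<open>star\<close> respects. All
  Kronecker products in the check matrices have an identity factor on one side.\<close>

lemma conj_transpose_kronecker_one_left [simp]:
  "conj_transpose (kronecker (1\<^sub>m n) B) = kronecker (1\<^sub>m n) (conj_transpose B)"
  by (rule eq_matI) (auto simp: less_mult_imp_div_less mod_less_of_less_mult)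

lemma conj_transpose_kronecker_one_right [simp]:
  "conj_transpose (kronecker A (1\<^sub>m n)) = kronecker (conj_transpose A) (1\<^sub>m n)"
  by (rule eq_matI) (auto simp: less_mult_imp_div_less mod_less_of_less_mult)

text \<open>The range is cut into m consecutive blocks of length n; in block i, k = i * n + j has
  quotient i and remainder j.\<close>

lemma sum_div_mod:
  fixes f :: "nat \<Rightarrow> nat \<Rightarrow> 'a::comm_monoid_add"
  shows "(\<Sum>k<m * n. f (k div n) (k mod n)) = (\<Sum>i<m. \<Sum>j<n. f i j)"
proof -
  have "(\<Sum>k<m * n. f (k div n) (k mod n)) =
      (\<Sum>i<m. \<Sum>k = i * n..<i * n + n. f (k div n) (k mod n))"
    by (rule sum.nat_group[symmetric])
  also have "\<dots> = (\<Sum>i<m. \<Sum>j<n. f i j)"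
  proof (rule sum.cong)
    fix i
    have "(\<Sum>k = i * n..<i * n + n. f (k div n) (k mod n)) =
        (\<Sum>j = 0..<n. f ((j + i * n) div n) ((j + i * n) mod n))"
      using sum.shift_bounds_nat_ivl[of "\<lambda>k. f (k div n) (k mod n)" 0 "i * n" n]
      by (simp add: add.commute)
    also have "\<dots> = (\<Sum>j<n. f i j)"
      by (rule sum.cong) auto
    finally show "(\<Sum>k = i * n..<i * n + n. f (k div n) (k mod n)) = (\<Sum>j<n. f i j)" .
  qed simp
  finally show ?thesis .
qed

text \<open>The inner summation index encodes a pair (k, l) of inner indices of the two factors; by
  commutativity the double sum splits into a product of two sums.\<close>

lemma kronecker_mult_kronecker:
  assumes "dim_col A = dim_row C" "dim_col B = dim_row D"
  shows "kronecker A B * kronecker C D = kronecker (A * C) (B * D)"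
proof (rule eq_matI)
  fix i j
  assume "i < dim_row (kronecker (A * C) (B * D))" "j < dim_col (kronecker (A * C) (B * D))"
  then have i: "i < dim_row A * dim_row B" and j: "j < dim_col C * dim_col D"
    by simp_all
  \<comment> \<open>Quotients and remainders are valid indices of the factors, so entries of
    \<open>A * C\<close> and \<open>B * D\<close> unfold to scalar products.\<close>
  note bounds = less_mult_imp_div_less[OF i] less_mult_imp_div_less[OF j]
    mod_less_of_less_mult[OF i] mod_less_of_less_mult[OF j]
  let ?f = "\<lambda>k l. (A $$ (i div dim_row B, k) * B $$ (i mod dim_row B, l)) *
    (C $$ (k, j div dim_col D) * D $$ (l, j mod dim_col D))"
  have "(kronecker A B * kronecker C D) $$ (i, j) =
      (\<Sum>k<dim_row C * dim_row D. ?f (k div dim_row D) (k mod dim_row D))"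
    using i j assms by (auto simp: scalar_prod_def lessThan_atLeast0 intro!: sum.cong)
  also have "\<dots> = (\<Sum>k<dim_row C. \<Sum>l<dim_row D. ?f k l)"
    by (rule sum_div_mod)
  also have "\<dots> = (\<Sum>k<dim_row C. A $$ (i div dim_row B, k) * C $$ (k, j div dim_col D)) *
      (\<Sum>l<dim_row D. B $$ (i mod dim_row B, l) * D $$ (l, j mod dim_col D))"
    by (simp add: sum_product algebra_simps)
  also have "\<dots> = kronecker (A * C) (B * D) $$ (i, j)"
    using i j bounds assms by (simp add: scalar_prod_def lessThan_atLeast0)
  finally show "(kronecker A B * kronecker C D) $$ (i, j) =
    kronecker (A * C) (B * D) $$ (i, j)" .
qed simp_all

section \<open>Block rows and products of check matrices\<close>

lemma dim_block_row [simp]: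
  "dim_row (block_row A B) = dim_row A" "dim_col (block_row A B) = dim_col A + dim_col B"
  by (simp_all add: block_row_def)

text \<open>This is block multiplication with an empty lower block row on the left and an empty
  right block column on the right.\<close>

lemma block_row_mult_conj_transpose:
  assumes "A \<in> carrier_mat m k" "B \<in> carrier_mat m l"
    "C \<in> carrier_mat n k" "D \<in> carrier_mat n l"
  shows "block_row A B * conj_transpose (block_row C D) =
    A * conj_transpose C + B * conj_transpose D"
proof -
  have "conj_transpose (block_row C D) =
      four_block_mat (conj_transpose C) (0\<^sub>m k 0) (conj_transpose D) (0\<^sub>m l 0)"
    using assms unfolding block_row_def
    by (subst conj_transpose_four_block_mat) auto
  moreover have "block_row A B = four_block_mat A B (0\<^sub>m 0 k) (0\<^sub>m 0 l)"
    using assms by (auto simp: block_row_def)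
  moreover have C: "conj_transpose C \<in> carrier_mat k n" and D: "conj_transpose D \<in> carrier_mat l n"
    using assms by auto
  moreover have "four_block_mat A B (0\<^sub>m 0 k) (0\<^sub>m 0 l) *
      four_block_mat (conj_transpose C) (0\<^sub>m k 0) (conj_transpose D) (0\<^sub>m l 0) =
      four_block_mat (A * conj_transpose C + B * conj_transpose D) (A * 0\<^sub>m k 0 + B * 0\<^sub>m l 0)
        (0\<^sub>m 0 k * conj_transpose C + 0\<^sub>m 0 l * conj_transpose D)
        (0\<^sub>m 0 k * 0\<^sub>m k 0 + 0\<^sub>m 0 l * 0\<^sub>m l 0)"
    by (rule mult_four_block_mat[OF assms(1,2) zero_carrier_mat zero_carrier_mat
          C zero_carrier_mat D zero_carrier_mat])
  \<comment> \<open>The other three blocks have no rows or no columns.\<close>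
  moreover have "\<dots> = A * conj_transpose C + B * conj_transpose D"
    using assms by (intro eq_matI) auto
  ultimately show ?thesis
    by simp
qed

text \<open>Two pairs of factors are allowed so that one computation serves three times: equal pairs
  give the CSS condition, data and connection factors in either order give the two sides of the
  square.\<close>

lemma lifted_product_mult:
  assumes "lifted_product Ha Hb = (HX, HZ)" "lifted_product Ha' Hb' = (HX', HZ')"
    and Ha': "Ha' \<in> carrier_mat (dim_row Ha) (dim_col Ha)"
    and Hb': "Hb' \<in> carrier_mat (dim_row Hb) (dim_col Hb)"
  shows "HX * conj_transpose HZ' = kronecker Ha Hb' + kronecker Ha' Hb"
proof -
  have HX: "HX = block_row (kronecker Ha (1\<^sub>m (dim_row Hb))) (kronecker (1\<^sub>m (dim_row Ha)) Hb)"
    using assms(1) by (simp add: lifted_product_def)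
  \<comment> \<open>The identities are sized by \<open>Ha\<close> and \<open>Hb\<close>, which have
    the sizes of \<open>Ha'\<close> and \<open>Hb'\<close>; this makes the mixed product rule
    applicable.\<close>
  have HZ': "HZ' = block_row (kronecker (1\<^sub>m (dim_col Ha)) (conj_transpose Hb'))
      (kronecker (conj_transpose Ha') (1\<^sub>m (dim_col Hb)))"
    using assms by (auto simp: lifted_product_def)
  have dims: "dim_row Ha' = dim_row Ha" "dim_col Ha' = dim_col Ha"
      "dim_row Hb' = dim_row Hb" "dim_col Hb' = dim_col Hb"
    using Ha' Hb' by auto
  let ?A = "kronecker Ha (1\<^sub>m (dim_row Hb))" and ?B = "kronecker (1\<^sub>m (dim_row Ha)) Hb"
  let ?C = "kronecker (1\<^sub>m (dim_col Ha)) (conj_transpose Hb')"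
    and ?D = "kronecker (conj_transpose Ha') (1\<^sub>m (dim_col Hb))"
  have A: "?A \<in> carrier_mat (dim_row Ha * dim_row Hb) (dim_col Ha * dim_row Hb)"
    and B: "?B \<in> carrier_mat (dim_row Ha * dim_row Hb) (dim_row Ha * dim_col Hb)"
    and C: "?C \<in> carrier_mat (dim_col Ha * dim_col Hb) (dim_col Ha * dim_row Hb)"
    and D: "?D \<in> carrier_mat (dim_col Ha * dim_col Hb) (dim_row Ha * dim_col Hb)"
    by (rule carrier_matI; simp add: dims)+
  have "HX * conj_transpose HZ' = ?A * conj_transpose ?C + ?B * conj_transpose ?D"
    unfolding HX HZ' by (rule block_row_mult_conj_transpose[OF A B C D])
  \<comment> \<open>The double conjugation cancels, leaving \<open>Hb'\<close> beside the
    identity.\<close>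
  also have "?A * conj_transpose ?C = kronecker (Ha * 1\<^sub>m (dim_col Ha)) (1\<^sub>m (dim_row Hb) * Hb')"
    by (simp only: conj_transpose_kronecker_one_left conj_transpose_conj_transpose
        kronecker_mult_kronecker index_one_mat dims)
  also have "\<dots> = kronecker Ha Hb'"
    using Hb' by (simp only: left_mult_one_mat right_mult_one_mat')
  also have "?B * conj_transpose ?D = kronecker (1\<^sub>m (dim_row Ha) * Ha') (Hb * 1\<^sub>m (dim_col Hb))"
    by (simp only: conj_transpose_kronecker_one_right conj_transpose_conj_transpose
        kronecker_mult_kronecker index_one_mat dims)
  also have "\<dots> = kronecker Ha' Hb"
    using Ha' by (simp only: left_mult_one_mat right_mult_one_mat')
  finally show ?thesis .
qed

section \<open>CSS conditions and the surgery\<close>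

lemma mat_add_self:
  fixes M :: "'p::finite lift_ring mat"
  shows "M + M = 0\<^sub>m (dim_row M) (dim_col M)"
  by (rule eq_matI) (simp_all add: lift_ring_add_self)

lemma css_code_lifted_product: "css_code (lifted_product Ha Hb)"
proof -
  obtain HX HZ where H: "lifted_product Ha Hb = (HX, HZ)"
    by (cases "lifted_product Ha Hb")
  moreover have "HX * conj_transpose HZ = kronecker Ha Hb + kronecker Ha Hb"
    using H by (intro lifted_product_mult) auto
  moreover have "dim_row HX = dim_row Ha * dim_row Hb" "dim_row HZ = dim_col Ha * dim_col Hb"
    "dim_col HZ = dim_col HX"
    using H by (auto simp: lifted_product_def)
  ultimately show ?thesis
    by (simp add: chain_complex_def mat_add_self)
qed

text \<open>Both factors of the product are block upper triangular. The diagonal blocks vanish by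
  the CSS condition of the data code; the upper right block is the sum of the two sides of
  \<open>commute\<close>.\<close>

lemma css_code_merged:
  assumes "css_code (HX, HZ)"
    and HX': "HX' \<in> carrier_mat (dim_row HX) (dim_col HX)"
    and HZ': "HZ' \<in> carrier_mat (dim_row HZ) (dim_col HZ)"
    and commute: "HX' * conj_transpose HZ = HX * conj_transpose HZ'"
  shows "css_code
    (four_block_mat HX HX' (0\<^sub>m (dim_row HX) (dim_col HX)) HX,
     four_block_mat HZ (0\<^sub>m (dim_row HZ) (dim_col HZ)) HZ' HZ)"
proof -
  let ?r = "dim_row HX" and ?n = "dim_col HX" and ?s = "dim_row HZ"
  have n: "dim_col HZ = ?n" and zero: "HX * conj_transpose HZ = 0\<^sub>m ?r ?s"
    using assms(1) by (simp_all add: chain_complex_def)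
  have HX: "HX \<in> carrier_mat ?r ?n" and HX': "HX' \<in> carrier_mat ?r ?n"
    and HZ: "conj_transpose HZ \<in> carrier_mat ?n ?s"
    and HZ'_star: "conj_transpose HZ' \<in> carrier_mat ?n ?s"
    using HX' HZ' n by auto
  have "conj_transpose (four_block_mat HZ (0\<^sub>m ?s ?n) HZ' HZ) =
      four_block_mat (conj_transpose HZ) (conj_transpose HZ') (0\<^sub>m ?n ?s) (conj_transpose HZ)"
    using HZ' n by (subst conj_transpose_four_block_mat) auto
  moreover have "four_block_mat HX HX' (0\<^sub>m ?r ?n) HX *
      four_block_mat (conj_transpose HZ) (conj_transpose HZ') (0\<^sub>m ?n ?s) (conj_transpose HZ) =
      four_block_mat (0\<^sub>m ?r ?s) (0\<^sub>m ?r ?s) (0\<^sub>m ?r ?s) (0\<^sub>m ?r ?s)"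
    using HX HX' HZ HZ'_star
    by (subst mult_four_block_mat[OF HX HX' zero_carrier_mat HX HZ HZ'_star zero_carrier_mat HZ])
      (simp add: zero commute mat_add_self carrier_matD[OF HZ']
        left_mult_zero_mat[OF HZ] left_mult_zero_mat[OF HZ'_star])
  moreover have "four_block_mat (0\<^sub>m ?r ?s) (0\<^sub>m ?r ?s) (0\<^sub>m ?r ?s) (0\<^sub>m ?r ?s) =
      (0\<^sub>m (?r + ?r) (?s + ?s) :: 'a lift_ring mat)"
    by (rule eq_matI) auto
  ultimately show ?thesis
    using n by (simp add: chain_complex_def)
qed

theorem lemmaV3:
  fixes Ha Hb HX HZ HX' HZ' :: "'p::finite lift_ring mat"
  assumes data: "(HX, HZ) = lifted_product Ha Hb"
    and connection: "product_connection_code Ha Hb (HX', HZ')"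
  shows "Z_surgery (HX, HZ) (conj_transpose HZ, HX) (conj_transpose HZ') HX'
    \<and> HX' * conj_transpose HZ = HX * conj_transpose HZ'
    \<and> merged_code (HX, HZ) (conj_transpose HZ, HX) (conj_transpose HZ') HX' =
        (four_block_mat HX HX' (0\<^sub>m (dim_row HX) (dim_col HX)) HX,
         four_block_mat HZ (0\<^sub>m (dim_row HZ) (dim_col HZ)) HZ' HZ)
    \<and> css_code
        (four_block_mat HX HX' (0\<^sub>m (dim_row HX) (dim_col HX)) HX,
         four_block_mat HZ (0\<^sub>m (dim_row HZ) (dim_col HZ)) HZ' HZ)"
proof -
  obtain Ha' Hb' where Ha': "Ha' \<in> carrier_mat (dim_row Ha) (dim_col Ha)"
    and Hb': "Hb' \<in> carrier_mat (dim_row Hb) (dim_col Hb)"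
    and P: "lifted_product Ha' Hb' = (HX', HZ')"
    using connection by (auto simp: product_connection_code_def)
  have css: "css_code (HX, HZ)"
    unfolding data by (rule css_code_lifted_product)
  then have n: "dim_col HZ = dim_col HX"
    by (simp add: chain_complex_def)
  have HX': "HX' \<in> carrier_mat (dim_row HX) (dim_col HX)"
    and HZ': "HZ' \<in> carrier_mat (dim_row HZ) (dim_col HZ)"
    using data P Ha' Hb' by (auto simp: lifted_product_def)
  have "HX * conj_transpose HZ' = kronecker Ha Hb' + kronecker Ha' Hb"
    by (rule lifted_product_mult[OF data[symmetric] P Ha' Hb'])
  also have "\<dots> = kronecker Ha' Hb + kronecker Ha Hb'"
    using Ha' Hb' by (intro comm_add_mat) auto
  \<comment> \<open>The swapped sum is the same formula with data and connection factors
    exchanged.\<close>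
  also have "\<dots> = HX' * conj_transpose HZ"
    using Ha' Hb' by (intro lifted_product_mult[OF P data[symmetric], symmetric]) auto
  finally have commute: "HX' * conj_transpose HZ = HX * conj_transpose HZ'" ..
  \<comment> \<open>\<open>merged_code\<close> conjugates the maps once more, which returns
    \<open>HZ'\<close> and \<open>HZ\<close>; \<open>n\<close> makes the sizes of the connecting
    maps fit.\<close>
  show ?thesis
    using css css_code_merged[OF css HX' HZ' commute] commute HX' HZ' n by auto
qed

end
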